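(* The functions $V_t^*$, $t\in\mathcal T$, satisfy $$V_t^*=\mathbb L_t^*V_{t+1}^*,\quad\forall t\in\mathcal T,\qquad\text{with } V_T^*(s_T,y_T):=-\lambda y_T^2 .$$ In addition, for every $t\in\mathcal T$ and $(s_t,y_t)\in\tilde{\mathcal S}$ there exists $a_t^*(s_t,y_t)\in\mathcal A(s_t)$ that attains the maximum in $\mathbb L_t^*V_{t+1}^*(s_t,y_t)$, and: (a) the Markov deterministic policy $\tilde u^*=(\tilde u_t^*;t\in\mathcal T)$ with $\tilde u_t^*(s_t,y_t)=a_t^*(s_t,y_t)$ is an optimal policy for the augmented MDP $\widetilde{\mathcal M}$, i.e. $V_0^{\tilde u^*}(s_0,y_0)=\sup_{\tilde u\in\tilde{\mathcal U}^{\rm HR}}V_0^{\tilde u}(s_0,y_0)$ for all $(s_0,y_0)\in\tilde{\mathcal S}$; (b) given $y_0\in\mathbb R$, the history-dependent deterministic policy $\hat u^*=(\hat u_t^*;t\in\mathcal T)\in\mathcal U^{\rm HD}$ with $$\hat u_t^*(s_0,a_0,\ldots,s_t):=\tilde u_t^*\Big(s_t,\,y_0-\sum_{\tau=0}^{t-1}r_\tau(s_\tau,a_\tau)\Big)$$ is an optimal policy for the pseudo mean-variance MDP $\hat{\mathcal M}(y_0)$, i.e. $\hat J_0^{\hat u^*}(s_0,y_0)=\sup_{u\in\mathcal U^{\rm HR}}\hat J_0^u(s_0,y_0)$ for all $s_0\in\mathcal S$.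
   Context: Original MDP. $\mathcal T=\{0,1,\ldots,T-1\}$ with $T<\infty$; $\mathcal S,\mathcal A$ are finite state and action spaces; $\mathcal A(s)\subset\mathcal A$ is the (nonempty) set of admissible actions at $s$, with $\cup_s\mathcal A(s)=\mathcal A$; $\mathcal K=\{(s,a):s\in\mathcal S,a\in\mathcal A(s)\}$; $P_t(\cdot|s,a)$ is a transition probability on $\mathcal S$ for each $(s,a)\in\mathcal K$, $t\in\mathcal T$; $r_t:\mathcal K\to\mathbb R$ is the reward function. A history-dependent randomized policy $u=(u_t)\in\mathcal U^{\rm HR}$ consists of probability distributions $u_t(\cdot|h_t)$ on $\mathcal A(s_t)$ given $h_t=(s_0,a_0,\ldots,s_{t-1},a_{t-1},s_t)$; $\mathcal U^{\rm HD}$ is the subset of history-dependent deterministic policies. $R_{t:T}=\sum_{\tau=t}^{T-1}r_\tau(s_\tau,a_\tau)$; $\lambda\ge0$ is fixed; $\hat J_0^u(s_0,y_0)=\mathbb E^u_{s_0}[R_{0:T}-\lambda(R_{0:T}-y_0)^2]$. The pseudo mean-variance MDP $\hat{\mathcal M}(y_0)$ is the problem of maximizing $\hat J_0^u(s_0,y_0)$ over $u\in\mathcal U^{\rm HR}$ for each $s_0$. Augmented MDP $\widetilde{\mathcal M}$. State space $\tilde{\mathcal S}=\mathcal S\times\mathbb R$; admissible actions at $(s,y)$ are $\mathcal A(s)$; taking $a_t$ in $(s_t,y_t)$ at time $t$ gives reward $r_t(s_t,a_t)$ and next state $(s_{t+1},y_{t+1})$ with $s_{t+1}\sim P_t(\cdot|s_t,a_t)$,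 $y_{t+1}=y_t-r_t(s_t,a_t)$; the terminal reward is $-\lambda y_T^2$. $\tilde{\mathcal U}^{\rm HR}$, $\tilde{\mathcal U}^{\rm MR}$, $\tilde{\mathcal U}^{\rm MD}$ are its sets of history-dependent randomized, Markov randomized and Markov deterministic policies (Markov: the decision at $t$ depends only on $(s_t,y_t)$). $V_0^{\tilde u}(s_0,y_0)=\mathbb E^{\tilde u}_{(s_0,y_0)}[\sum_{t=0}^{T-1}r_t(s_t,a_t)-\lambda y_T^2]$. For $\tilde u\in\tilde{\mathcal U}^{\rm MR}$ and $t\in\mathcal T$, $$V_t^{\tilde u}(s_t,y_t)=\mathbb E^{\tilde u}\big[R_{t:T}-\lambda(R_{t:T}-y_t)^2\,\big|\,s_t,y_t\big],\qquad V_t^*(s_t,y_t)=\sup_{\tilde u\in\tilde{\mathcal U}^{\rm MR}}V_t^{\tilde u}(s_t,y_t),$$ where the expectation is for the process in state $(s_t,y_t)$ at time $t$ and following $\tilde u$ from then on. For a function $v:\tilde{\mathcal S}\to\mathbb R$ and $t\in\mathcal T$, $$\mathbb L_t^*v(s,y)=\max_{a\in\mathcal A(s)}\Big\{r_t(s,a)+\sum_{s'\in\mathcal S}P_t(s'|s,a)\,v(s',y-r_t(s,a))\Big\}.$$ *)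

theory Defs
  imports "HOL-Probability.Probability"
begin

text \<open>Transition laws and rewards are total functions; their values at inadmissible
  state-action pairs are irrelevant, since admissible policies never reach them.\<close>

record ('s, 'a) mdp =
  horizon :: nat
  admissible :: "'s \<Rightarrow> 'a set"
  kernel :: "nat \<Rightarrow> 's \<Rightarrow> 'a \<Rightarrow> 's pmf"
  reward :: "nat \<Rightarrow> 's \<Rightarrow> 'a \<Rightarrow> real"

text \<open>The history \<open>(s\<^sub>0, a\<^sub>0, \<dots>, s\<^bsub>t-1\<^esub>, a\<^bsub>t-1\<^esub>, s\<^sub>t)\<close> is
  encoded as \<open>([(s\<^sub>0, a\<^sub>0), \<dots>, (s\<^bsub>t-1\<^esub>, a\<^bsub>t-1\<^esub>)], s\<^sub>t)\<close>.\<close>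

type_synonym ('s, 'a) hist = "('s \<times> 'a) list \<times> 's"

definition histories :: "('s, 'a) mdp \<Rightarrow> nat \<Rightarrow> ('s, 'a) hist set" where
  "histories M t = {(h, s). length h = t \<and> (\<forall>(x, a) \<in> set h. a \<in> admissible M x)}"

definition policies_HR :: "('s, 'a) mdp \<Rightarrow> (nat \<Rightarrow> ('s, 'a) hist \<Rightarrow> 'a pmf) set" where
  "policies_HR M =
     {u. \<forall>t < horizon M. \<forall>h \<in> histories M t. set_pmf (u t h) \<subseteq> admissible M (snd h)}"

definition policies_HD :: "('s, 'a) mdp \<Rightarrow> (nat \<Rightarrow> ('s, 'a) hist \<Rightarrow> 'a) set" where
  "policies_HD M =
     {d. \<forall>t < horizon M. \<forall>h \<in> histories M t. d t h \<in> admissible M (snd h)}"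

definition policies_MR :: "('s, 'a) mdp \<Rightarrow> (nat \<Rightarrow> 's \<Rightarrow> 'a pmf) set" where
  "policies_MR M = {u. \<forall>t < horizon M. \<forall>s. set_pmf (u t s) \<subseteq> admissible M s}"

definition policies_MD :: "('s, 'a) mdp \<Rightarrow> (nat \<Rightarrow> 's \<Rightarrow> 'a) set" where
  "policies_MD M = {d. \<forall>t < horizon M. \<forall>s. d t s \<in> admissible M s}"

text \<open>The next three functions realise the inclusions of the smaller policy classes in the
  class of history-dependent randomized policies.\<close>

definition HD_as_HR :: "(nat \<Rightarrow> ('s, 'a) hist \<Rightarrow> 'a) \<Rightarrow> nat \<Rightarrow> ('s, 'a) hist \<Rightarrow> 'a pmf" where
  "HD_as_HR d = (\<lambda>t h. return_pmf (d t h))"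

definition MR_as_HR :: "(nat \<Rightarrow> 's \<Rightarrow> 'a pmf) \<Rightarrow> nat \<Rightarrow> ('s, 'a) hist \<Rightarrow> 'a pmf" where
  "MR_as_HR u = (\<lambda>t h. u t (snd h))"

definition MD_as_HR :: "(nat \<Rightarrow> 's \<Rightarrow> 'a) \<Rightarrow> nat \<Rightarrow> ('s, 'a) hist \<Rightarrow> 'a pmf" where
  "MD_as_HR d = (\<lambda>t h. return_pmf (d t (snd h)))"

text \<open>Law of the trajectory over \<open>n\<close> steps, started in state \<open>s\<close> at time \<open>t\<close> with the
  policy \<open>u\<close>. The recorded history begins at time \<open>t\<close>, so for \<open>t > 0\<close> this is used with
  Markov policies only.\<close>

primrec trajectory ::
  "('s, 'a) mdp \<Rightarrow> (nat \<Rightarrow> ('s, 'a) hist \<Rightarrow> 'a pmf) \<Rightarrow> nat \<Rightarrow> 's \<Rightarrow> nat \<Rightarrow> ('s, 'a) hist pmf"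
where
  "trajectory M u t s 0 = return_pmf ([], s)"
| "trajectory M u t s (Suc n) =
     do { (h, x) \<leftarrow> trajectory M u t s n;
          a \<leftarrow> u (t + n) (h, x);
          x' \<leftarrow> kernel M (t + n) x a;
          return_pmf (h @ [(x, a)], x') }"

definition cum_reward :: "('s, 'a) mdp \<Rightarrow> nat \<Rightarrow> ('s \<times> 'a) list \<Rightarrow> real" where
  "cum_reward M t h = (\<Sum>i < length h. reward M (t + i) (fst (h ! i)) (snd (h ! i)))"

text \<open>The objective of the pseudo mean-variance problem with target \<open>y\<close>.\<close>

definition pseudo_MV ::
  "real \<Rightarrow> ('s, 'a) mdp \<Rightarrow> (nat \<Rightarrow> ('s, 'a) hist \<Rightarrow> 'a pmf) \<Rightarrow> 's \<Rightarrow> real \<Rightarrow> real"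
where
  "pseudo_MV lam M u s y =
     measure_pmf.expectation (trajectory M u 0 s (horizon M))
       (\<lambda>(h, _). cum_reward M 0 h - lam * (cum_reward M 0 h - y)\<^sup>2)"

definition augmented :: "('s, 'a) mdp \<Rightarrow> ('s \<times> real, 'a) mdp" where
  "augmented M =
     \<lparr> horizon = horizon M,
       admissible = (\<lambda>(s, y). admissible M s),
       kernel = (\<lambda>t (s, y) a. map_pmf (\<lambda>s'. (s', y - reward M t s a)) (kernel M t s a)),
       reward = (\<lambda>t (s, y) a. reward M t s a) \<rparr>"

definition aug_value ::
  "real \<Rightarrow> ('s, 'a) mdp \<Rightarrow> (nat \<Rightarrow> ('s \<times> real, 'a) hist \<Rightarrow> 'a pmf) \<Rightarrow> 's \<times> real \<Rightarrow> real"
where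
  "aug_value lam M u x =
     measure_pmf.expectation (trajectory (augmented M) u 0 x (horizon M))
       (\<lambda>(h, (_, y_T)). cum_reward (augmented M) 0 h - lam * y_T\<^sup>2)"

text \<open>The value \<open>V\<^sub>t\<close> of a Markov randomized policy from time \<open>t\<close> on.\<close>

definition aug_value_MR ::
  "real \<Rightarrow> ('s, 'a) mdp \<Rightarrow> (nat \<Rightarrow> 's \<times> real \<Rightarrow> 'a pmf) \<Rightarrow> nat \<Rightarrow> 's \<times> real \<Rightarrow> real"
where
  "aug_value_MR lam M u t x =
     measure_pmf.expectation (trajectory (augmented M) (MR_as_HR u) t x (horizon M - t))
       (\<lambda>(h, _). cum_reward (augmented M) t h
                   - lam * (cum_reward (augmented M) t h - snd x)\<^sup>2)"

text \<open>For finite state and action types every trajectory law has finite support, uniformly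
  in the policy, so this real supremum is over a bounded set.\<close>

definition opt_value :: "real \<Rightarrow> ('s, 'a) mdp \<Rightarrow> nat \<Rightarrow> 's \<times> real \<Rightarrow> real" where
  "opt_value lam M t x =
     (if t < horizon M
      then (SUP u \<in> policies_MR (augmented M). aug_value_MR lam M u t x)
      else - lam * (snd x)\<^sup>2)"

definition action_value ::
  "('s::finite, 'a) mdp \<Rightarrow> nat \<Rightarrow> ('s \<times> real \<Rightarrow> real) \<Rightarrow> 's \<times> real \<Rightarrow> 'a \<Rightarrow> real"
where
  "action_value M t v = (\<lambda>(s, y) a.
     reward M t s a + (\<Sum>s' \<in> UNIV. pmf (kernel M t s a) s' * v (s', y - reward M t s a)))"

definition bellman ::
  "('s::finite, 'a) mdp \<Rightarrow> nat \<Rightarrow> ('s \<times> real \<Rightarrow> real) \<Rightarrow> 's \<times> real \<Rightarrow> real"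
where
  "bellman M t v x = Max (action_value M t v x ` admissible M (fst x))"

definition induced_policy ::
  "('s, 'a) mdp \<Rightarrow> real \<Rightarrow> (nat \<Rightarrow> 's \<times> real \<Rightarrow> 'a) \<Rightarrow> nat \<Rightarrow> ('s, 'a) hist \<Rightarrow> 'a"
where
  "induced_policy M y0 d = (\<lambda>t (h, s). d t (s, y0 - cum_reward M 0 h))"

end

theory Submission
  imports Defs
begin

text \<open>If \<open>v\<close> solves the Bellman recursion, then the reward collected so far plus \<open>v\<close> at the current
  augmented state is, along every trajectory, a supermartingale for every admissible policy and a
  martingale for a policy that picks maximizing actions. Comparing its expectation at the initial
  and at the final time bounds the value of every policy by \<open>v\<close>, with equality for greedy ones.
  The target process \<open>y\<close> is a function of the collected reward, so the same potential works on
  histories of the original MDP, and the two models need not be coupled.\<close>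

section \<open>Expectations under finitely supported laws\<close>

lemma expectation_bind_pmf_finite:
  fixes f :: "'b \<Rightarrow> real"
  assumes "finite (set_pmf p)" "\<And>x. x \<in> set_pmf p \<Longrightarrow> finite (set_pmf (q x))"
  shows "measure_pmf.expectation (p \<bind> q) f
       = measure_pmf.expectation p (\<lambda>x. measure_pmf.expectation (q x) f)"
  using assms
  by (simp add: pmf_expectation_bind[of "set_pmf p"] integral_measure_pmf[of "set_pmf p"])

lemma expectation_mono_pmf_finite:
  fixes f g :: "'b \<Rightarrow> real"
  assumes "finite (set_pmf p)" "\<And>x. x \<in> set_pmf p \<Longrightarrow> f x \<le> g x"
  shows "measure_pmf.expectation p f \<le> measure_pmf.expectation p g"
  using assms
  by (intro integral_mono_AE integrable_measure_pmf_finite) (auto simp: AE_measure_pmf_iff)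

lemma expectation_cong_pmf:
  fixes f g :: "'b \<Rightarrow> real"
  assumes "\<And>x. x \<in> set_pmf p \<Longrightarrow> f x = g x"
  shows "measure_pmf.expectation p f = measure_pmf.expectation p g"
  using assms by (intro integral_cong_AE) (auto simp: AE_measure_pmf_iff)

lemma expectation_const_add_finite:
  fixes f :: "'b::finite \<Rightarrow> real"
  shows "measure_pmf.expectation p (\<lambda>x. c + f x) = c + (\<Sum>x\<in>UNIV. pmf p x * f x)"
  by (subst Bochner_Integration.integral_add)
    (auto simp: integrable_measure_pmf_finite integral_measure_pmf[of UNIV])

section \<open>Trajectory laws and potentials along them\<close>

lemma cum_reward_snoc:
  "cum_reward M t (h @ [(x, a)]) = cum_reward M t h + reward M (t + length h) x a"
  by (auto simp: cum_reward_def nth_append intro!: sum.cong)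

lemma cum_reward_Nil [simp]: "cum_reward M t [] = 0"
  by (simp add: cum_reward_def)

text \<open>A trajectory started at \<open>t\<close> has recorded only \<open>k\<close> steps by
  time \<open>t + k\<close>, whereas \<open>policies_HR\<close> restricts actions at that time on
  histories of length \<open>t + k\<close>. Measuring the length from the start covers both
  history-dependent policies from time 0 and Markov policies started later.\<close>

definition admissible_from ::
  "('s, 'a) mdp \<Rightarrow> nat \<Rightarrow> nat \<Rightarrow> (nat \<Rightarrow> ('s, 'a) hist \<Rightarrow> 'a pmf) \<Rightarrow> bool"
where
  "admissible_from M t n u \<longleftrightarrow>
     (\<forall>k < n. \<forall>h \<in> histories M k. set_pmf (u (t + k) h) \<subseteq> admissible M (snd h))"

lemma set_pmf_trajectory_Suc:
  "set_pmf (trajectory M u t s (Suc n)) =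
     (\<Union>(h, x) \<in> set_pmf (trajectory M u t s n). \<Union>a \<in> set_pmf (u (t + n) (h, x)).
        (\<lambda>x'. (h @ [(x, a)], x')) ` set_pmf (kernel M (t + n) x a))"
  by (force simp: case_prod_unfold)

lemma trajectory_in_histories:
  assumes "admissible_from M t n u"
  shows "set_pmf (trajectory M u t s n) \<subseteq> histories M n"
  using assms
proof (induction n)
  case 0
  show ?case by (simp add: histories_def)
next
  case (Suc n)
  then have IH: "set_pmf (trajectory M u t s n) \<subseteq> histories M n"
    by (simp add: admissible_from_def)
  have adm: "a \<in> admissible M x" if "(h, x) \<in> histories M n" "a \<in> set_pmf (u (t + n) (h, x))" for h x a
    using Suc.prems that unfolding admissible_from_def by fastforce
  show ?case
    unfolding set_pmf_trajectory_Suc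
  proof clarify
    fix h x a x'
    assume "(h, x) \<in> set_pmf (trajectory M u t s n)" "a \<in> set_pmf (u (t + n) (h, x))"
    with IH adm have "(h, x) \<in> histories M n" "a \<in> admissible M x" by auto
    then show "(h @ [(x, a)], x') \<in> histories M (Suc n)" by (auto simp: histories_def)
  qed
qed

text \<open>The augmented state type is infinite, so finite support has to come from the transition
  laws; both models have this property.\<close>

definition finite_kernels :: "('s, 'a) mdp \<Rightarrow> bool" where
  "finite_kernels M \<longleftrightarrow> (\<forall>t s a. finite (set_pmf (kernel M t s a)))"

lemma finite_trajectory:
  fixes M :: "('s, 'a::finite) mdp"
  assumes "finite_kernels M"
  shows "finite (set_pmf (trajectory M u t s n))"
proof (induction n)
  case (Suc n)
  then show ?case
    unfolding set_pmf_trajectory_Suc using assms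
    by (auto simp: finite_kernels_def)
qed simp

lemma expectation_trajectory_Suc:
  fixes M :: "('s, 'a::finite) mdp" and f :: "('s, 'a) hist \<Rightarrow> real"
  assumes "finite_kernels M"
  shows "measure_pmf.expectation (trajectory M u t s (Suc n)) f =
    measure_pmf.expectation (trajectory M u t s n) (\<lambda>(h, x).
      measure_pmf.expectation (u (t + n) (h, x)) (\<lambda>a.
        measure_pmf.expectation (kernel M (t + n) x a) (\<lambda>x'. f (h @ [(x, a)], x'))))"
proof -
  have "finite (set_pmf (kernel M t x a))" for t x a
    using assms by (simp add: finite_kernels_def)
  then show ?thesis
    using finite_trajectory[OF assms, of u t s n]
    by (simp add: expectation_bind_pmf_finite case_prod_unfold)
qed

text \<open>By the tower property, averaging the one-step inequality over the last action shows that
  the expected potential cannot increase. The index \<open>k\<close> counts steps since the start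
  and \<Phi> sees the whole recorded history, so the lemma serves both models.\<close>

lemma supermartingale_trajectory:
  fixes M :: "('s, 'a::finite) mdp" and \<Phi> :: "nat \<Rightarrow> ('s, 'a) hist \<Rightarrow> real"
  assumes fin: "finite_kernels M"
    and adm: "admissible_from M t n u"
    and step: "\<And>k h x a. k < n \<Longrightarrow> (h, x) \<in> histories M k \<Longrightarrow> a \<in> set_pmf (u (t + k) (h, x)) \<Longrightarrow>
      measure_pmf.expectation (kernel M (t + k) x a) (\<lambda>x'. \<Phi> (Suc k) (h @ [(x, a)], x')) \<le> \<Phi> k (h, x)"
  shows "measure_pmf.expectation (trajectory M u t s n) (\<Phi> n) \<le> \<Phi> 0 ([], s)"
  using adm step
proof (induction n)
  case (Suc n)
  from Suc.prems(1) have adm: "admissible_from M t n u"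
    by (simp add: admissible_from_def)
  \<comment> \<open>Every action in the support obeys the same bound, hence so does their average:
    the comparison is with a constant function.\<close>
  have act: "measure_pmf.expectation (u (t + n) (h, x)) (\<lambda>a.
        measure_pmf.expectation (kernel M (t + n) x a) (\<lambda>x'. \<Phi> (Suc n) (h @ [(x, a)], x'))) \<le> \<Phi> n (h, x)"
    if "(h, x) \<in> histories M n" for h x
    using expectation_mono_pmf_finite[of "u (t + n) (h, x)" _ "\<lambda>_. \<Phi> n (h, x)"] Suc.prems(2) that
    by simp
  have "measure_pmf.expectation (trajectory M u t s (Suc n)) (\<Phi> (Suc n))
      \<le> measure_pmf.expectation (trajectory M u t s n) (\<Phi> n)"
    unfolding expectation_trajectory_Suc[OF fin]
    by (intro expectation_mono_pmf_finite finite_trajectory fin)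
      (use trajectory_in_histories[OF adm] act in fastforce)
  also have "\<dots> \<le> \<Phi> 0 ([], s)"
    using Suc.IH adm Suc.prems(2) by simp
  finally show ?case .
qed simp

lemma submartingale_trajectory:
  fixes M :: "('s, 'a::finite) mdp" and \<Phi> :: "nat \<Rightarrow> ('s, 'a) hist \<Rightarrow> real"
  assumes "finite_kernels M" "admissible_from M t n u"
    and "\<And>k h x a. k < n \<Longrightarrow> (h, x) \<in> histories M k \<Longrightarrow> a \<in> set_pmf (u (t + k) (h, x)) \<Longrightarrow>
      \<Phi> k (h, x) \<le> measure_pmf.expectation (kernel M (t + k) x a) (\<lambda>x'. \<Phi> (Suc k) (h @ [(x, a)], x'))"
  shows "\<Phi> 0 ([], s) \<le> measure_pmf.expectation (trajectory M u t s n) (\<Phi> n)"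
  using supermartingale_trajectory[of M t n u "\<lambda>k h. - \<Phi> k h" s] assms by simp

section \<open>The augmented MDP and its target coordinate\<close>

lemma finite_kernels_finite [simp]: "finite_kernels (M :: ('s::finite, 'a) mdp)"
  by (simp add: finite_kernels_def)

lemma finite_kernels_augmented [simp]:
  "finite_kernels (augmented (M :: ('s::finite, 'a) mdp))"
  by (auto simp: finite_kernels_def augmented_def)

lemma augmented_simps [simp]:
  "horizon (augmented M) = horizon M"
  "admissible (augmented M) x = admissible M (fst x)"
  "reward (augmented M) t x a = reward M t (fst x) a"
  by (auto simp: augmented_def split: prod.splits)

text \<open>Past reward leaves the expectation, and what remains is the action value. The
  supermartingale step thus becomes a comparison of \<open>action_value\<close> with the potential
  function at the current state.\<close>

lemma expectation_augmented_kernel: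
  fixes M :: "('s::finite, 'a) mdp"
  assumes "length h = k"
  shows "measure_pmf.expectation (kernel (augmented M) (t + k) x a)
      (\<lambda>x'. cum_reward (augmented M) t (h @ [(x, a)]) + v x')
    = cum_reward (augmented M) t h + action_value M (t + k) v x a"
  using assms
  by (cases x) (simp add: augmented_def cum_reward_snoc action_value_def expectation_const_add_finite)

text \<open>Subtracting the old total and then the new reward is the same as subtracting the new
  total, so the target recomputed from the history follows the dynamics of the augmented
  coordinate.\<close>

lemma expectation_kernel_target:
  fixes M :: "('s::finite, 'a) mdp"
  assumes "length h = k"
  shows "measure_pmf.expectation (kernel M k s a)
      (\<lambda>s'. cum_reward M 0 (h @ [(s, a)]) + v (s', y - cum_reward M 0 (h @ [(s, a)])))
    = cum_reward M 0 h + action_value M k v (s, y - cum_reward M 0 h) a"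
  using assms
  by (simp add: cum_reward_snoc action_value_def expectation_const_add_finite diff_diff_eq)

text \<open>Each augmented transition subtracts the reward it pays, so target plus collected reward
  is conserved. The length is carried along because it fixes the time at which the next reward is
  read.\<close>

lemma augmented_target:
  assumes "(h, x) \<in> set_pmf (trajectory (augmented M) u t x0 n)"
  shows "length h = n \<and> snd x = snd x0 - cum_reward (augmented M) t h"
  using assms
proof (induction n arbitrary: h x)
  case (Suc n)
  then obtain g z a where g: "(g, z) \<in> set_pmf (trajectory (augmented M) u t x0 n)"
    and h: "h = g @ [(z, a)]" and x: "x \<in> set_pmf (kernel (augmented M) (t + n) z a)"
    unfolding set_pmf_trajectory_Suc by auto
  from x have "snd x = snd z - reward M (t + n) (fst z) a"
    by (cases z) (auto simp: augmented_def)
  with Suc.IH[OF g] show ?case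
    by (simp add: h cum_reward_snoc)
qed simp

text \<open>By this conservation the quadratic penalty agrees with the terminal reward on the
  support, so values from every start time share the form of \<open>aug_value\<close>.\<close>

lemma aug_value_MR_terminal:
  "aug_value_MR lam M u t x =
     measure_pmf.expectation (trajectory (augmented M) (MR_as_HR u) t x (horizon M - t))
       (\<lambda>(h, x'). cum_reward (augmented M) t h - lam * (snd x')\<^sup>2)"
  unfolding aug_value_MR_def
  by (intro expectation_cong_pmf)
    (auto dest!: augmented_target simp: power2_commute)

section \<open>Bellman recursion and greedy policies\<close>

lemma action_value_le_bellman:
  fixes M :: "('s::finite, 'a::finite) mdp"
  assumes "a \<in> admissible M (fst x)"
  shows "action_value M t v x a \<le> bellman M t v x"
  using assms by (simp add: bellman_def)

lemma bellman_attained: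
  fixes M :: "('s::finite, 'a::finite) mdp"
  assumes "admissible M (fst x) \<noteq> {}"
  shows "\<exists>a \<in> admissible M (fst x). action_value M t v x a = bellman M t v x"
proof -
  have "bellman M t v x \<in> action_value M t v x ` admissible M (fst x)"
    unfolding bellman_def using assms by (intro Max_in) auto
  then show ?thesis by force
qed

text \<open>The bounds are proved for an abstract solution first, since it is part of the claim that
  \<open>opt_value\<close> is one.\<close>

definition bellman_solution ::
  "real \<Rightarrow> ('s::finite, 'a::finite) mdp \<Rightarrow> (nat \<Rightarrow> 's \<times> real \<Rightarrow> real) \<Rightarrow> bool"
where
  "bellman_solution lam M v \<longleftrightarrow>
     (\<forall>t < horizon M. v t = bellman M t (v (Suc t))) \<and> (\<forall>x. v (horizon M) x = - lam * (snd x)\<^sup>2)"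

lemma bellman_solution_exists: "\<exists>v. bellman_solution lam M v"
proof -
  \<comment> \<open>\<open>w k\<close> is the solution with \<open>k\<close> steps to go; with
    \<open>Suc k\<close> steps to go the decision falls at time
    \<open>horizon M - Suc k\<close>.\<close>
  define w where "w = rec_nat (\<lambda>x. - lam * (snd x)\<^sup>2) (\<lambda>k. bellman M (horizon M - Suc k))"
  have "w (horizon M - t) = bellman M t (w (horizon M - Suc t))" if "t < horizon M" for t
  proof -
    have "horizon M - t = Suc (horizon M - Suc t)" "horizon M - Suc (horizon M - Suc t) = t"
      using that by simp_all
    then show ?thesis by (simp add: w_def)
  qed
  then have "bellman_solution lam M (\<lambda>t. w (horizon M - t))"
    by (simp add: bellman_solution_def w_def)
  then show ?thesis by blast
qed

definition greedy ::
  "('s::finite, 'a::finite) mdp \<Rightarrow> (nat \<Rightarrow> 's \<times> real \<Rightarrow> real) \<Rightarrow> (nat \<Rightarrow> 's \<times> real \<Rightarrow> 'a) \<Rightarrow> bool"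
where
  "greedy M v d \<longleftrightarrow> (\<forall>t < horizon M. \<forall>x. d t x \<in> admissible M (fst x)
     \<and> action_value M t (v (Suc t)) x (d t x) = bellman M t (v (Suc t)) x)"

lemma greedy_exists:
  assumes "\<forall>s. admissible M s \<noteq> {}"
  shows "\<exists>d. greedy M v d"
proof -
  have "\<forall>t x. \<exists>a. a \<in> admissible M (fst x)
      \<and> action_value M t (v (Suc t)) x a = bellman M t (v (Suc t)) x"
    using bellman_attained assms by blast
  then show ?thesis unfolding greedy_def by metis
qed

section \<open>Values of policies in the augmented MDP\<close>

lemma admissible_from_HR: "u \<in> policies_HR M \<Longrightarrow> admissible_from M 0 (horizon M) u"
  by (simp add: policies_HR_def admissible_from_def)

lemma admissible_from_MR:
  "u \<in> policies_MR M \<Longrightarrow> t \<le> horizon M \<Longrightarrow> admissible_from M t (horizon M - t) (MR_as_HR u)"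
  by (simp add: policies_MR_def admissible_from_def MR_as_HR_def)

text \<open>Start time and policy are left general: Markov policies started at \<open>t\<close>
  yield the bound on \<open>opt_value\<close>, history-dependent ones started at 0 yield
  optimality.\<close>

lemma expectation_augmented_le:
  fixes M :: "('s::finite, 'a::finite) mdp"
  assumes sol: "bellman_solution lam M v" and t: "t \<le> horizon M"
    and adm: "admissible_from (augmented M) t (horizon M - t) u"
  shows "measure_pmf.expectation (trajectory (augmented M) u t x (horizon M - t))
       (\<lambda>(h, x'). cum_reward (augmented M) t h - lam * (snd x')\<^sup>2) \<le> v t x"
proof -
  define \<Phi> where "\<Phi> = (\<lambda>k (h, z). cum_reward (augmented M) t h + v (t + k) z)"
  have "measure_pmf.expectation (trajectory (augmented M) u t x (horizon M - t)) (\<Phi> (horizon M - t))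
      \<le> \<Phi> 0 ([], x)"
  proof (rule supermartingale_trajectory[OF _ adm])
    fix k h z a
    assume k: "k < horizon M - t" and h: "(h, z) \<in> histories (augmented M) k"
      and a: "a \<in> set_pmf (u (t + k) (h, z))"
    have "set_pmf (u (t + k) (h, z)) \<subseteq> admissible M (fst z)"
      using adm k h unfolding admissible_from_def by force
    with a have "a \<in> admissible M (fst z)" by blast
    then have "action_value M (t + k) (v (Suc (t + k))) z a \<le> v (t + k) z"
      using sol k by (auto simp: bellman_solution_def intro: action_value_le_bellman)
    moreover have "length h = k" using h by (simp add: histories_def)
    ultimately show "measure_pmf.expectation (kernel (augmented M) (t + k) z a)
        (\<lambda>x'. \<Phi> (Suc k) (h @ [(z, a)], x')) \<le> \<Phi> k (h, z)"
      by (simp add: \<Phi>_def expectation_augmented_kernel)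
  qed simp
  \<comment> \<open>\<open>t + (horizon M - t)\<close> is the horizon because \<open>t\<close> does
    not exceed it, and there \<open>v\<close> is the terminal reward.\<close>
  moreover have "\<Phi> (horizon M - t) = (\<lambda>(h, x'). cum_reward (augmented M) t h - lam * (snd x')\<^sup>2)"
    using sol t by (auto simp: \<Phi>_def bellman_solution_def)
  ultimately show ?thesis by (simp add: \<Phi>_def)
qed

text \<open>Greedy actions make the action value equal to \<open>v\<close>, so the same potential is
  also a submartingale and the upper bound is met from below.\<close>

lemma expectation_augmented_greedy:
  fixes M :: "('s::finite, 'a::finite) mdp"
  assumes sol: "bellman_solution lam M v" and t: "t \<le> horizon M" and d: "greedy M v d"
  shows "measure_pmf.expectation (trajectory (augmented M) (MD_as_HR d) t x (horizon M - t))
       (\<lambda>(h, x'). cum_reward (augmented M) t h - lam * (snd x')\<^sup>2) = v t x"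
proof (rule antisym)
  have adm: "admissible_from (augmented M) t (horizon M - t) (MD_as_HR d)"
    using d by (simp add: admissible_from_def MD_as_HR_def greedy_def del: split_paired_All)
  show "measure_pmf.expectation (trajectory (augmented M) (MD_as_HR d) t x (horizon M - t))
       (\<lambda>(h, x'). cum_reward (augmented M) t h - lam * (snd x')\<^sup>2) \<le> v t x"
    by (rule expectation_augmented_le[OF sol t adm])
  define \<Phi> where "\<Phi> = (\<lambda>k (h, z). cum_reward (augmented M) t h + v (t + k) z)"
  have "\<Phi> 0 ([], x) \<le>
      measure_pmf.expectation (trajectory (augmented M) (MD_as_HR d) t x (horizon M - t)) (\<Phi> (horizon M - t))"
  proof (rule submartingale_trajectory[OF _ adm])
    fix k h z a
    assume k: "k < horizon M - t" and h: "(h, z) \<in> histories (augmented M) k"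
      and a: "a \<in> set_pmf (MD_as_HR d (t + k) (h, z))"
    from a have "a = d (t + k) z" by (simp add: MD_as_HR_def)
    with sol d k have "action_value M (t + k) (v (Suc (t + k))) z a = v (t + k) z"
      by (simp add: bellman_solution_def greedy_def del: split_paired_All)
    moreover have "length h = k" using h by (simp add: histories_def)
    ultimately show "\<Phi> k (h, z) \<le> measure_pmf.expectation (kernel (augmented M) (t + k) z a)
        (\<lambda>x'. \<Phi> (Suc k) (h @ [(z, a)], x'))"
      by (simp add: \<Phi>_def expectation_augmented_kernel)
  qed simp
  moreover have "\<Phi> (horizon M - t) = (\<lambda>(h, x'). cum_reward (augmented M) t h - lam * (snd x')\<^sup>2)"
    using sol t by (auto simp: \<Phi>_def bellman_solution_def)
  ultimately show "v t x \<le>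
      measure_pmf.expectation (trajectory (augmented M) (MD_as_HR d) t x (horizon M - t))
       (\<lambda>(h, x'). cum_reward (augmented M) t h - lam * (snd x')\<^sup>2)"
    by (simp add: \<Phi>_def)
qed

section \<open>Values in the pseudo mean-variance problem\<close>

lemma pseudo_MV_le:
  fixes M :: "('s::finite, 'a::finite) mdp"
  assumes sol: "bellman_solution lam M v" and u: "u \<in> policies_HR M"
  shows "pseudo_MV lam M u s y \<le> v 0 (s, y)"
proof -
  note adm = admissible_from_HR[OF u]
  \<comment> \<open>\<open>y\<close> minus the collected reward stands for the augmented coordinate.
    At the horizon it enters squared, which turns the potential into the pseudo mean-variance
    objective.\<close>
  define \<Phi> where "\<Phi> = (\<lambda>k (h, x). cum_reward M 0 h + v k (x, y - cum_reward M 0 h))"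
  have "measure_pmf.expectation (trajectory M u 0 s (horizon M)) (\<Phi> (horizon M)) \<le> \<Phi> 0 ([], s)"
  proof (rule supermartingale_trajectory[OF _ adm])
    fix k h x a
    assume k: "k < horizon M" and h: "(h, x) \<in> histories M k" and a: "a \<in> set_pmf (u (0 + k) (h, x))"
    have "set_pmf (u k (h, x)) \<subseteq> admissible M x"
      using u k h unfolding policies_HR_def by force
    with a have "a \<in> admissible M x" by auto
    then have "action_value M k (v (Suc k)) (x, y - cum_reward M 0 h) a \<le> v k (x, y - cum_reward M 0 h)"
      using sol k by (auto simp: bellman_solution_def intro: action_value_le_bellman)
    moreover have "length h = k" using h by (simp add: histories_def)
    ultimately show "measure_pmf.expectation (kernel M (0 + k) x a)
        (\<lambda>x'. \<Phi> (Suc k) (h @ [(x, a)], x')) \<le> \<Phi> k (h, x)"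
      by (simp add: \<Phi>_def expectation_kernel_target)
  qed simp
  moreover have "\<Phi> (horizon M) = (\<lambda>(h, _). cum_reward M 0 h - lam * (cum_reward M 0 h - y)\<^sup>2)"
    using sol by (auto simp: \<Phi>_def bellman_solution_def power2_commute)
  ultimately show ?thesis by (simp add: \<Phi>_def pseudo_MV_def)
qed

lemma induced_policy_HD: "greedy M v d \<Longrightarrow> induced_policy M y d \<in> policies_HD M"
  by (auto simp: greedy_def policies_HD_def induced_policy_def)

lemma HD_as_HR_policy: "d \<in> policies_HD M \<Longrightarrow> HD_as_HR d \<in> policies_HR M"
  by (simp add: policies_HD_def policies_HR_def HD_as_HR_def)

lemma pseudo_MV_induced_greedy:
  fixes M :: "('s::finite, 'a::finite) mdp"
  assumes sol: "bellman_solution lam M v" and d: "greedy M v d"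
  shows "pseudo_MV lam M (HD_as_HR (induced_policy M y d)) s y = v 0 (s, y)"
proof (rule antisym)
  let ?u = "HD_as_HR (induced_policy M y d)"
  have u: "?u \<in> policies_HR M"
    using d by (intro HD_as_HR_policy induced_policy_HD)
  then show "pseudo_MV lam M ?u s y \<le> v 0 (s, y)"
    by (rule pseudo_MV_le[OF sol])
  define \<Phi> where "\<Phi> = (\<lambda>k (h, x). cum_reward M 0 h + v k (x, y - cum_reward M 0 h))"
  have "\<Phi> 0 ([], s) \<le> measure_pmf.expectation (trajectory M ?u 0 s (horizon M)) (\<Phi> (horizon M))"
  proof (rule submartingale_trajectory[OF _ admissible_from_HR[OF u]])
    fix k h x a
    assume k: "k < horizon M" and h: "(h, x) \<in> histories M k" and a: "a \<in> set_pmf (?u (0 + k) (h, x))"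
    \<comment> \<open>\<open>induced_policy\<close> evaluates \<open>d\<close> at exactly the target
      that occurs in \<Phi>, so greediness of \<open>d\<close> applies there.\<close>
    from a have "a = d k (x, y - cum_reward M 0 h)" by (simp add: HD_as_HR_def induced_policy_def)
    with sol d k have "action_value M k (v (Suc k)) (x, y - cum_reward M 0 h) a
        = v k (x, y - cum_reward M 0 h)"
      by (simp add: bellman_solution_def greedy_def)
    moreover have "length h = k" using h by (simp add: histories_def)
    ultimately show "\<Phi> k (h, x) \<le> measure_pmf.expectation (kernel M (0 + k) x a)
        (\<lambda>x'. \<Phi> (Suc k) (h @ [(x, a)], x'))"
      by (simp add: \<Phi>_def expectation_kernel_target)
  qed simp
  moreover have "\<Phi> (horizon M) = (\<lambda>(h, _). cum_reward M 0 h - lam * (cum_reward M 0 h - y)\<^sup>2)"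
    using sol by (auto simp: \<Phi>_def bellman_solution_def power2_commute)
  ultimately show "v 0 (s, y) \<le> pseudo_MV lam M ?u s y" by (simp add: \<Phi>_def pseudo_MV_def)
qed

section \<open>Optimal values and optimal policies\<close>

lemma opt_value_eq_solution:
  fixes M :: "('s::finite, 'a::finite) mdp"
  assumes ne: "\<forall>s. admissible M s \<noteq> {}" and sol: "bellman_solution lam M v" and t: "t \<le> horizon M"
  shows "opt_value lam M t = v t"
proof
  fix x
  show "opt_value lam M t x = v t x"
  proof (cases "t < horizon M")
    case True
    obtain d where d: "greedy M v d" using greedy_exists[OF ne] by blast
    \<comment> \<open>Point masses place the greedy policy in the Markov randomized class, where it
      attains the bound \<open>v t x\<close>.\<close>
    let ?u = "\<lambda>t x. return_pmf (d t x)"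
    have u: "?u \<in> policies_MR (augmented M)"
      using d by (simp add: greedy_def policies_MR_def)
    have "MR_as_HR ?u = MD_as_HR d" by (simp add: MR_as_HR_def MD_as_HR_def)
    then have "aug_value_MR lam M ?u t x = v t x"
      using expectation_augmented_greedy[OF sol t d] by (simp add: aug_value_MR_terminal)
    moreover have "aug_value_MR lam M u t x \<le> v t x" if "u \<in> policies_MR (augmented M)" for u
      unfolding aug_value_MR_terminal
      using expectation_augmented_le[OF sol t] admissible_from_MR[OF that] t by simp
    ultimately have "(SUP u \<in> policies_MR (augmented M). aug_value_MR lam M u t x) = v t x"
      using u by (intro cSup_eq_maximum) force+
    with True show ?thesis by (simp add: opt_value_def)
  next
    \<comment> \<open>Only \<open>t = horizon M\<close> remains, where both sides are the terminal
      reward.\<close>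
    case False
    with t sol show ?thesis by (simp add: opt_value_def bellman_solution_def del: split_paired_All)
  qed
qed

text \<open>Some solution exists and \<open>opt_value\<close> agrees with it up to the horizon, so
  the recursion transfers without interchanging a supremum and an expectation. For
  \<open>t < horizon M\<close> the agreement covers both \<open>t\<close> and
  \<open>Suc t\<close>.\<close>

lemma bellman_solution_opt_value:
  fixes M :: "('s::finite, 'a::finite) mdp"
  assumes "\<forall>s. admissible M s \<noteq> {}"
  shows "bellman_solution lam M (opt_value lam M)"
proof -
  obtain v where v: "bellman_solution lam M v" using bellman_solution_exists by blast
  then show ?thesis
    using opt_value_eq_solution[OF assms v] by (simp add: bellman_solution_def Suc_leI)
qed

lemma aug_value_greedy_optimal:
  fixes M :: "('s::finite, 'a::finite) mdp"
  assumes sol: "bellman_solution lam M v" and d: "greedy M v d"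
  shows "aug_value lam M (MD_as_HR d) x = (SUP u \<in> policies_HR (augmented M). aug_value lam M u x)"
proof (rule sym, rule cSup_eq_maximum)
  have "MD_as_HR d \<in> policies_HR (augmented M)"
    using d by (simp add: greedy_def policies_HR_def MD_as_HR_def del: split_paired_All)
  then show "aug_value lam M (MD_as_HR d) x \<in> (\<lambda>u. aug_value lam M u x) ` policies_HR (augmented M)"
    by blast
  \<comment> \<open>\<open>horizon M - 0\<close> matches the remaining horizon in the lemmas for a
    general start time, used here at 0.\<close>
  have val: "aug_value lam M u x = measure_pmf.expectation (trajectory (augmented M) u 0 x (horizon M - 0))
      (\<lambda>(h, x'). cum_reward (augmented M) 0 h - lam * (snd x')\<^sup>2)" for u
    by (simp add: aug_value_def case_prod_unfold)
  fix r assume "r \<in> (\<lambda>u. aug_value lam M u x) ` policies_HR (augmented M)"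
  then obtain u where u: "u \<in> policies_HR (augmented M)" and r: "r = aug_value lam M u x" by blast
  have "r \<le> v 0 x"
    unfolding r val
    by (rule expectation_augmented_le[OF sol]) (use admissible_from_HR[OF u] in simp_all)
  also have "v 0 x = aug_value lam M (MD_as_HR d) x"
    unfolding val by (rule expectation_augmented_greedy[OF sol _ d, symmetric]) simp
  finally show "r \<le> aug_value lam M (MD_as_HR d) x" .
qed

lemma pseudo_MV_induced_optimal:
  fixes M :: "('s::finite, 'a::finite) mdp"
  assumes sol: "bellman_solution lam M v" and d: "greedy M v d"
  shows "pseudo_MV lam M (HD_as_HR (induced_policy M y d)) s y
       = (SUP u \<in> policies_HR M. pseudo_MV lam M u s y)"
proof (rule sym, rule cSup_eq_maximum)
  show "pseudo_MV lam M (HD_as_HR (induced_policy M y d)) s y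
      \<in> (\<lambda>u. pseudo_MV lam M u s y) ` policies_HR M"
    by (intro imageI HD_as_HR_policy induced_policy_HD[OF d])
qed (use pseudo_MV_le[OF sol] pseudo_MV_induced_greedy[OF sol d] in auto)

theorem theorem2:
  fixes M :: "('s::finite, 'a::finite) mdp" and lam :: real
  assumes "\<forall>s. admissible M s \<noteq> {}"
    and "(\<Union>s. admissible M s) = UNIV"
    and "lam \<ge> 0"
  shows
    "(\<forall>t < horizon M. opt_value lam M t = bellman M t (opt_value lam M (Suc t)))
     \<and> (\<forall>x. opt_value lam M (horizon M) x = - lam * (snd x)\<^sup>2)
     \<and> (\<forall>t < horizon M. \<forall>x. \<exists>a \<in> admissible M (fst x).
          action_value M t (opt_value lam M (Suc t)) x a
            = bellman M t (opt_value lam M (Suc t)) x)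
     \<and> (\<forall>astar :: nat \<Rightarrow> 's \<times> real \<Rightarrow> 'a.
          (\<forall>t < horizon M. \<forall>x. astar t x \<in> admissible M (fst x)
             \<and> action_value M t (opt_value lam M (Suc t)) x (astar t x)
                 = bellman M t (opt_value lam M (Suc t)) x)
          \<longrightarrow>
          (astar \<in> policies_MD (augmented M)
           \<and> (\<forall>x. aug_value lam M (MD_as_HR astar) x
                    = (SUP u \<in> policies_HR (augmented M). aug_value lam M u x)))
          \<and> (\<forall>y0. induced_policy M y0 astar \<in> policies_HD M
               \<and> (\<forall>s0. pseudo_MV lam M (HD_as_HR (induced_policy M y0 astar)) s0 y0
                        = (SUP u \<in> policies_HR M. pseudo_MV lam M u s0 y0))))"
proof -
  note sol = bellman_solution_opt_value[OF assms(1), of lam]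
  show ?thesis
  proof (intro conjI allI impI)
    fix t assume "t < horizon M"
    with sol show "opt_value lam M t = bellman M t (opt_value lam M (Suc t))"
      by (simp add: bellman_solution_def)
  next
    fix x
    show "opt_value lam M (horizon M) x = - lam * (snd x)\<^sup>2"
      by (simp add: opt_value_def)
  next
    fix t x
    show "\<exists>a \<in> admissible M (fst x). action_value M t (opt_value lam M (Suc t)) x a
        = bellman M t (opt_value lam M (Suc t)) x"
      using assms(1) by (simp add: bellman_attained)
  next
    fix astar :: "nat \<Rightarrow> 's \<times> real \<Rightarrow> 'a" and x y0 s0
    assume "\<forall>t < horizon M. \<forall>x. astar t x \<in> admissible M (fst x)
        \<and> action_value M t (opt_value lam M (Suc t)) x (astar t x)
            = bellman M t (opt_value lam M (Suc t)) x"
    \<comment> \<open>With \<open>opt_value\<close> as the solution, \<open>greedy\<close> is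
      exactly the assumed maximization property of \<open>astar\<close>.\<close>
    then have d: "greedy M (opt_value lam M) astar" by (simp add: greedy_def)
    then show "astar \<in> policies_MD (augmented M)" by (simp add: greedy_def policies_MD_def)
    show "aug_value lam M (MD_as_HR astar) x
        = (SUP u \<in> policies_HR (augmented M). aug_value lam M u x)"
      by (rule aug_value_greedy_optimal[OF sol d])
    show "induced_policy M y0 astar \<in> policies_HD M"
      by (rule induced_policy_HD[OF d])
    show "pseudo_MV lam M (HD_as_HR (induced_policy M y0 astar)) s0 y0
        = (SUP u \<in> policies_HR M. pseudo_MV lam M u s0 y0)"
      by (rule pseudo_MV_induced_optimal[OF sol d])
  qed
qed

end
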